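(* The sequent calculi $\mathbf{S4}$ and $\mathbf{GL}$ have monotone feasible $\mathrm{MDIP}$: for $G\in\{\mathbf{S4},\mathbf{GL}\}$ with logic $L\in\{\mathsf{S4},\mathsf{GL}\}$ respectively, there is a polynomial $p$ such that for any $G$-proof $u$ of a formula $\phi\to\Box\psi\vee\Box\theta$ with $\phi$ monotone, with code $w$, there are monotone $\mathcal{L}_\Box$-circuits $C$ and $D$ of size at most $p(|u|,|w|)$ such that $([C],[D])$ is an $L$-MDI for $\phi\to\Box\psi\vee\Box\theta$.
   Context: Modal formulas ($\mathcal{L}_\Box$) are over $\{\top,\bot,\wedge,\vee,\to,\Box\}$; monotone means containing no implication. $\mathbf{S4}$ is the classical sequent calculus $\mathbf{LK}$ (with cut) over $\mathcal{L}_\Box$ extended by the rules: from $\Gamma,\phi\Rightarrow\Delta$ infer $\Gamma,\Box\phi\Rightarrow\Delta$; and from $\Box\Gamma\Rightarrow\phi$ infer $\Box\Gamma\Rightarrow\Box\phi$. $\mathbf{GL}$ is $\mathbf{LK}$ extended by the rule: from $\Box\Gamma,\Gamma,\Box\phi\Rightarrow\phi$ infer $\Box\Gamma\Rightarrow\Box\phi$. A $G$-proof of a formula $\chi$ is a proof of $\Rightarrow\chi$; $\mathsf{S4}$, $\mathsf{GL}$ are the sets of formulas so provable. Monotone $\mathcal{L}_\Box$-circuits have gates among $\top,\bot,\wedge,\vee,\Box$; $[C]$ is the unfolded formula. An $L$-MDI for $(\phi\to\Box\psi\vee\Box\theta)\in L$ is a pair $(I,J)$ with atoms among those of $\phi$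 such that $\phi\to I\vee J$, $I\to\Box\psi$, $J\to\Box\theta$ are in $L$. *)

theory Defs
  imports "HOL-Library.Multiset" "HOL-Computational_Algebra.Polynomial"
begin

datatype fm =
  Atom nat | Top | Bot | And fm fm | Or fm fm | Imp fm fm | Box fm

fun atoms :: "fm \<Rightarrow> nat set" where
  "atoms (Atom n) = {n}"
| "atoms Top = {}"
| "atoms Bot = {}"
| "atoms (And \<phi> \<psi>) = atoms \<phi> \<union> atoms \<psi>"
| "atoms (Or \<phi> \<psi>) = atoms \<phi> \<union> atoms \<psi>"
| "atoms (Imp \<phi> \<psi>) = atoms \<phi> \<union> atoms \<psi>"
| "atoms (Box \<phi>) = atoms \<phi>"

fun monotone_fm :: "fm \<Rightarrow> bool" where
  "monotone_fm (Atom n) \<longleftrightarrow> True"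
| "monotone_fm Top \<longleftrightarrow> True"
| "monotone_fm Bot \<longleftrightarrow> True"
| "monotone_fm (And \<phi> \<psi>) \<longleftrightarrow> monotone_fm \<phi> \<and> monotone_fm \<psi>"
| "monotone_fm (Or \<phi> \<psi>) \<longleftrightarrow> monotone_fm \<phi> \<and> monotone_fm \<psi>"
| "monotone_fm (Imp \<phi> \<psi>) \<longleftrightarrow> False"
| "monotone_fm (Box \<phi>) \<longleftrightarrow> monotone_fm \<phi>"


subsection \<open>Sequent calculi\<close>

type_synonym sequent = "fm multiset \<times> fm multiset"

text \<open>A calculus is given by its inference steps: the list of premises and the conclusion.\<close>

type_synonym calculus = "sequent list \<Rightarrow> sequent \<Rightarrow> bool"

inductive LK :: calculus where
  Ax: "LK [] ({#\<phi>#}, {#\<phi>#})"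
| BotL: "LK [] ({#Bot#}, {#})"
| TopR: "LK [] ({#}, {#Top#})"
| WeakL: "LK [(\<Gamma>, \<Delta>)] (add_mset \<phi> \<Gamma>, \<Delta>)"
| WeakR: "LK [(\<Gamma>, \<Delta>)] (\<Gamma>, add_mset \<phi> \<Delta>)"
| ContrL: "LK [(add_mset \<phi> (add_mset \<phi> \<Gamma>), \<Delta>)] (add_mset \<phi> \<Gamma>, \<Delta>)"
| ContrR: "LK [(\<Gamma>, add_mset \<phi> (add_mset \<phi> \<Delta>))] (\<Gamma>, add_mset \<phi> \<Delta>)"
| Cut: "LK [(\<Gamma>, add_mset \<phi> \<Delta>), (add_mset \<phi> \<Gamma>', \<Delta>')] (\<Gamma> + \<Gamma>', \<Delta> + \<Delta>')"
| AndL1: "LK [(add_mset \<phi> \<Gamma>, \<Delta>)] (add_mset (And \<phi> \<psi>) \<Gamma>, \<Delta>)"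
| AndL2: "LK [(add_mset \<psi> \<Gamma>, \<Delta>)] (add_mset (And \<phi> \<psi>) \<Gamma>, \<Delta>)"
| AndR: "LK [(\<Gamma>, add_mset \<phi> \<Delta>), (\<Gamma>, add_mset \<psi> \<Delta>)] (\<Gamma>, add_mset (And \<phi> \<psi>) \<Delta>)"
| OrL: "LK [(add_mset \<phi> \<Gamma>, \<Delta>), (add_mset \<psi> \<Gamma>, \<Delta>)] (add_mset (Or \<phi> \<psi>) \<Gamma>, \<Delta>)"
| OrR1: "LK [(\<Gamma>, add_mset \<phi> \<Delta>)] (\<Gamma>, add_mset (Or \<phi> \<psi>) \<Delta>)"
| OrR2: "LK [(\<Gamma>, add_mset \<psi> \<Delta>)] (\<Gamma>, add_mset (Or \<phi> \<psi>) \<Delta>)"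
| ImpL: "LK [(\<Gamma>, add_mset \<phi> \<Delta>), (add_mset \<psi> \<Gamma>, \<Delta>)] (add_mset (Imp \<phi> \<psi>) \<Gamma>, \<Delta>)"
| ImpR: "LK [(add_mset \<phi> \<Gamma>, add_mset \<psi> \<Delta>)] (\<Gamma>, add_mset (Imp \<phi> \<psi>) \<Delta>)"

inductive S4 :: calculus where
  LK: "LK ps s \<Longrightarrow> S4 ps s"
| BoxL: "S4 [(add_mset \<phi> \<Gamma>, \<Delta>)] (add_mset (Box \<phi>) \<Gamma>, \<Delta>)"
| BoxR: "S4 [(image_mset Box \<Gamma>, {#\<phi>#})] (image_mset Box \<Gamma>, {#Box \<phi>#})"

inductive GL :: calculus where
  LK: "LK ps s \<Longrightarrow> GL ps s"
| BoxGL: "GL [(image_mset Box \<Gamma> + \<Gamma> + {#Box \<phi>#}, {#\<phi>#})] (image_mset Box \<Gamma>, {#Box \<phi>#})"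

text \<open>Proofs are dag-like: a proof is a sequence of lines, and a line may be used as a premise any
  number of times. For the sake of coding, the two multisets of a line are written down as lists;
  the order of the formulas in these lists is irrelevant for inferences.\<close>

type_synonym line = "fm list \<times> fm list"

definition sequent_of :: "line \<Rightarrow> sequent" where
  "sequent_of l = (mset (fst l), mset (snd l))"

definition is_proof :: "calculus \<Rightarrow> line list \<Rightarrow> fm \<Rightarrow> bool" where
  "is_proof G u \<chi> \<longleftrightarrow>
     (\<forall>i<length u. \<exists>ps. set ps \<subseteq> sequent_of ` set (take i u) \<and> G ps (sequent_of (u ! i))) \<and>
     u \<noteq> [] \<and> last u = ([], [\<chi>])"

definition logic_of :: "calculus \<Rightarrow> fm set" where
  "logic_of G = {\<chi>. \<exists>u. is_proof G u \<chi>}"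


subsection \<open>Binary codes of formulas and proofs\<close>

text \<open>Self-delimiting: binary digits, least significant first, each preceded by \<^term>\<open>True\<close>.\<close>

fun code_nat :: "nat \<Rightarrow> bool list" where
  "code_nat n = (if n = 0 then [False] else True # odd n # code_nat (n div 2))"

declare code_nat.simps [simp del]

fun code_fm :: "fm \<Rightarrow> bool list" where
  "code_fm (Atom n) = [False, False, False] @ code_nat n"
| "code_fm Top = [False, False, True]"
| "code_fm Bot = [False, True, False]"
| "code_fm (And \<phi> \<psi>) = [False, True, True] @ code_fm \<phi> @ code_fm \<psi>"
| "code_fm (Or \<phi> \<psi>) = [True, False, False] @ code_fm \<phi> @ code_fm \<psi>"
| "code_fm (Imp \<phi> \<psi>) = [True, False, True] @ code_fm \<phi> @ code_fm \<psi>"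
| "code_fm (Box \<phi>) = [True, True, False] @ code_fm \<phi>"

text \<open>The remaining three-bit block is the end marker of a list of formulas.\<close>

definition code_fms :: "fm list \<Rightarrow> bool list" where
  "code_fms \<Gamma> = concat (map code_fm \<Gamma>) @ [True, True, True]"

definition code_proof :: "line list \<Rightarrow> bool list" where
  "code_proof u = concat (map (\<lambda>(\<Gamma>, \<Delta>). code_fms \<Gamma> @ code_fms \<Delta>) u)"

lemma code_nat_prefix:
  "code_nat m @ xs = code_nat n @ ys \<Longrightarrow> m = n \<and> xs = ys"
proof (induction m arbitrary: n rule: less_induct)
  case (less m)
  show ?case
  proof (cases "m = 0 \<or> n = 0")
    case True
    then show ?thesis
      using less.prems by (auto simp: code_nat.simps[of m] code_nat.simps[of n] split: if_splits)
  next
    case False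
    then have "odd m = odd n" and "code_nat (m div 2) @ xs = code_nat (n div 2) @ ys"
      using less.prems by (auto simp: code_nat.simps[of m] code_nat.simps[of n])
    moreover from this(2) have "m div 2 = n div 2" "xs = ys"
      using less.IH[of "m div 2" "n div 2"] False by auto
    ultimately show ?thesis
      by (metis even_two_times_div_two odd_two_times_div_two_succ)
  qed
qed

lemma code_fm_prefix:
  "code_fm \<phi> @ xs = code_fm \<psi> @ ys \<Longrightarrow> \<phi> = \<psi> \<and> xs = ys"
proof (induction \<phi> arbitrary: \<psi> xs ys)
  case (Atom n)
  then show ?case by (cases \<psi>) (auto dest: code_nat_prefix)
next
  case Top
  then show ?case by (cases \<psi>) auto
next
  case Bot
  then show ?case by (cases \<psi>) auto
next
  case (And \<phi>1 \<phi>2)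
  show ?case using And.prems by (cases \<psi>) (auto dest!: And.IH)
next
  case (Or \<phi>1 \<phi>2)
  show ?case using Or.prems by (cases \<psi>) (auto dest!: Or.IH)
next
  case (Imp \<phi>1 \<phi>2)
  show ?case using Imp.prems by (cases \<psi>) (auto dest!: Imp.IH)
next
  case (Box \<phi>)
  show ?case using Box.prems by (cases \<psi>) (auto dest!: Box.IH)
qed

lemma code_fms_prefix:
  "code_fms \<Gamma> @ xs = code_fms \<Delta> @ ys \<Longrightarrow> \<Gamma> = \<Delta> \<and> xs = ys"
proof (induction \<Gamma> arbitrary: \<Delta>)
  case Nil
  then show ?case
  proof (cases \<Delta>)
    case (Cons \<phi> \<Delta>')
    with Nil show ?thesis by (cases \<phi>) (auto simp: code_fms_def)
  qed (simp add: code_fms_def)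
next
  case (Cons \<phi> \<Gamma>)
  show ?case
  proof (cases \<Delta>)
    case Nil
    with Cons.prems show ?thesis by (cases \<phi>) (auto simp: code_fms_def)
  next
    case (Cons \<psi> \<Delta>')
    with Cons.prems have "code_fm \<phi> @ (code_fms \<Gamma> @ xs) = code_fm \<psi> @ (code_fms \<Delta>' @ ys)"
      by (simp add: code_fms_def)
    then show ?thesis
      using Cons Cons.IH[of \<Delta>'] by (auto dest: code_fm_prefix)
  qed
qed

lemma inj_code_fm: "inj code_fm"
  by (rule injI) (metis append_Nil2 code_fm_prefix)

lemma inj_code_proof: "inj code_proof"
proof (rule injI)
  fix u v
  show "code_proof u = code_proof v \<Longrightarrow> u = v"
  proof (induction u arbitrary: v)
    case Nil
    then show ?case by (cases v) (auto simp: code_proof_def code_fms_def)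
  next
    case (Cons l u)
    obtain \<Gamma> \<Delta> where l: "l = (\<Gamma>, \<Delta>)" by (cases l)
    with Cons.prems obtain \<Gamma>' \<Delta>' v' where v: "v = (\<Gamma>', \<Delta>') # v'"
      by (cases v) (auto simp: code_proof_def code_fms_def)
    have "code_fms \<Gamma> @ (code_fms \<Delta> @ code_proof u) = code_fms \<Gamma>' @ (code_fms \<Delta>' @ code_proof v')"
      using Cons.prems by (simp add: l v code_proof_def)
    then have "\<Gamma> = \<Gamma>'" "\<Delta> = \<Delta>'" "code_proof u = code_proof v'"
      by (auto dest!: code_fms_prefix)
    with Cons.IH show ?case by (simp add: l v)
  qed
qed


subsection \<open>Monotone circuits\<close>

text \<open>A circuit is a sequence of gates; the inputs of a gate are given by the positions of earlier
  gates, and the last gate is the output.\<close>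

datatype mgate = GAtom nat | GTop | GBot | GAnd nat nat | GOr nat nat | GBox nat

type_synonym mcircuit = "mgate list"

fun gate_inputs :: "mgate \<Rightarrow> nat set" where
  "gate_inputs (GAtom n) = {}"
| "gate_inputs GTop = {}"
| "gate_inputs GBot = {}"
| "gate_inputs (GAnd i j) = {i, j}"
| "gate_inputs (GOr i j) = {i, j}"
| "gate_inputs (GBox i) = {i}"

definition is_mcircuit :: "mcircuit \<Rightarrow> bool" where
  "is_mcircuit C \<longleftrightarrow> C \<noteq> [] \<and> (\<forall>k<length C. \<forall>i\<in>gate_inputs (C ! k). i < k)"

definition circuit_size :: "mcircuit \<Rightarrow> nat" where
  "circuit_size C = length C"

fun gate_fm :: "fm list \<Rightarrow> mgate \<Rightarrow> fm" where
  "gate_fm Fs (GAtom n) = Atom n"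
| "gate_fm Fs GTop = Top"
| "gate_fm Fs GBot = Bot"
| "gate_fm Fs (GAnd i j) = And (Fs ! i) (Fs ! j)"
| "gate_fm Fs (GOr i j) = Or (Fs ! i) (Fs ! j)"
| "gate_fm Fs (GBox i) = Box (Fs ! i)"

definition unfold_gates :: "mcircuit \<Rightarrow> fm list" where
  "unfold_gates C = foldl (\<lambda>Fs g. Fs @ [gate_fm Fs g]) [] C"

definition circuit_fm :: "mcircuit \<Rightarrow> fm" where
  "circuit_fm C = last (unfold_gates C)"


subsection \<open>Disjunctive interpolants\<close>

definition is_MDI :: "fm set \<Rightarrow> fm \<times> fm \<Rightarrow> fm \<Rightarrow> fm \<Rightarrow> fm \<Rightarrow> bool" where
  "is_MDI L = (\<lambda>(I, J) \<phi> \<psi> \<theta>.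
     Imp \<phi> (Or (Box \<psi>) (Box \<theta>)) \<in> L \<and>
     atoms I \<subseteq> atoms \<phi> \<and> atoms J \<subseteq> atoms \<phi> \<and>
     Imp \<phi> (Or I J) \<in> L \<and> Imp I (Box \<psi>) \<in> L \<and> Imp J (Box \<theta>) \<in> L)"

text \<open>Value of a bivariate polynomial, represented as a polynomial in the second variable whose
  coefficients are polynomials in the first.\<close>

definition poly2 :: "nat poly poly \<Rightarrow> nat \<Rightarrow> nat \<Rightarrow> nat" where
  "poly2 p x y = poly (poly p [:y:]) x"

end

theory Submission
  imports Defs
begin

text \<open>
  Read every line \<open>\<Gamma> \<Rightarrow> A\<close> of the given proof with a single succedent as a Horn clause. Starting
  from the subformulas of the monotone formula \<open>\<phi>\<close>, fire these clauses for one round more than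
  the proof has lines. Recording which clauses fired yields, for each formula \<open>B\<close>, a
  monotone formula \<open>e B\<close> over the atoms of \<open>\<phi>\<close> that implies \<open>B\<close>, and all
  \<open>e B\<close> are computed by one small circuit; the interpolants are \<open>e (\<box>\<psi>)\<close> and \<open>e (\<box>\<theta>)\<close>.

  For \<open>\<phi> \<rightarrow> e (\<box>\<psi>) \<or> e (\<box>\<theta>)\<close> let \<open>M\<close> be a maximal consistent set, let
  \<open>X\<close> be the set of all \<open>B\<close> with \<open>e B \<in> M\<close>, and evaluate formulas classically, where
  \<open>\<box>A\<close> counts as true if \<open>\<box>A \<in> X\<close> and, for \<open>S4\<close> only, also \<open>A\<close> is true (a variant of the
  Kleene--Aczel slash). Since \<open>X\<close> is closed under the clauses, all lines of the proof are true. If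
  \<open>\<phi> \<in> M\<close>, then \<open>\<phi>\<close> is true because it is monotone, hence \<open>\<box>\<psi>\<close> or \<open>\<box>\<theta>\<close> is true and
  thus belongs to \<open>X\<close>.
\<close>

section \<open>Derivability and proofs\<close>

text \<open>Tree-like derivability ignores sharing. This is harmless for membership in a logic,
  which carries no size bound, and gives rule induction without positions.\<close>

inductive derivable :: "calculus \<Rightarrow> sequent \<Rightarrow> bool" for G where
  step: "G ps s \<Longrightarrow> (\<And>p. p \<in> set ps \<Longrightarrow> derivable G p) \<Longrightarrow> derivable G s"

definition derivation :: "calculus \<Rightarrow> line list \<Rightarrow> bool" where
  "derivation G u \<longleftrightarrow>
     (\<forall>i<length u. \<exists>ps. set ps \<subseteq> sequent_of ` set (take i u) \<and> G ps (sequent_of (u ! i)))"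

lemma derivation_append:
  assumes "derivation G u" and "derivation G v"
  shows "derivation G (u @ v)"
  unfolding derivation_def
proof (intro allI impI)
  fix i
  assume i: "i < length (u @ v)"
  show "\<exists>ps. set ps \<subseteq> sequent_of ` set (take i (u @ v)) \<and> G ps (sequent_of ((u @ v) ! i))"
  proof (cases "i < length u")
    case True
    then show ?thesis
      using assms(1) by (auto simp: derivation_def nth_append)
  next
    case False
    with i have "i - length u < length v"
      by auto
    with assms(2) obtain ps where
      "set ps \<subseteq> sequent_of ` set (take (i - length u) v)" "G ps (sequent_of (v ! (i - length u)))"
      unfolding derivation_def by blast
    with False show ?thesis
      by (intro exI[of _ ps]) (auto simp: nth_append)
  qed
qed

lemma derivation_snoc:
  assumes "derivation G u" and "set ps \<subseteq> sequent_of ` set u" and "G ps (sequent_of l)"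
  shows "derivation G (u @ [l])"
  unfolding derivation_def
proof (intro allI impI)
  fix i
  assume "i < length (u @ [l])"
  then consider "i < length u" | "i = length u"
    by fastforce
  then show "\<exists>ps. set ps \<subseteq> sequent_of ` set (take i (u @ [l])) \<and> G ps (sequent_of ((u @ [l]) ! i))"
  proof cases
    case 1
    then show ?thesis
      using assms(1) by (auto simp: derivation_def nth_append)
  next
    case 2
    then show ?thesis
      using assms(2,3) by (intro exI[of _ ps]) auto
  qed
qed

lemma derivable_imp_derivation:
  "derivable G s \<Longrightarrow> \<exists>u l. derivation G (u @ [l]) \<and> sequent_of l = s"
proof (induction rule: derivable.induct)
  case (step ps s)
  \<comment> \<open>Collect the premises one at a time: derivations may simply be concatenated.
    Generalising to \<open>qs\<close> makes induction on the list possible.\<close>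
  have "\<exists>u. derivation G u \<and> set qs \<subseteq> sequent_of ` set u" if "set qs \<subseteq> set ps" for qs
    using that
  proof (induction qs)
    case Nil
    show ?case by (rule exI[of _ "[]"]) (simp add: derivation_def)
  next
    case (Cons q qs)
    then obtain u where u: "derivation G u" "set qs \<subseteq> sequent_of ` set u"
      by auto
    obtain v l where v: "derivation G (v @ [l])" "sequent_of l = q"
      using step.IH[of q] Cons.prems by auto
    show ?case
      using derivation_append[OF u(1) v(1)] u(2) v(2) by (intro exI[of _ "u @ v @ [l]"]) auto
  qed
  then obtain u where u: "derivation G u" "set ps \<subseteq> sequent_of ` set u"
    by blast
  obtain \<Gamma> \<Delta> where "mset \<Gamma> = fst s" "mset \<Delta> = snd s"
    using ex_mset by metis
  then have "sequent_of (\<Gamma>, \<Delta>) = s"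
    by (simp add: sequent_of_def)
  then show ?case
    using derivation_snoc[OF u] step.hyps(1) by metis
qed

lemma derivable_imp_logic_of:
  assumes "derivable G ({#}, {#\<chi>#})"
  shows "\<chi> \<in> logic_of G"
proof -
  obtain u l where u: "derivation G (u @ [l])" "sequent_of l = ({#}, {#\<chi>#})"
    using derivable_imp_derivation[OF assms] by blast
  then have "l = ([], [\<chi>])"
    by (cases l) (simp add: sequent_of_def)
  with u show ?thesis
    unfolding logic_of_def is_proof_def derivation_def by fastforce
qed

text \<open>Unlike rule induction on \<open>derivable\<close>, the step keeps the fact that the
  current line occurs in \<open>u\<close>. The modal rules need it, because the slash is sound only
  relative to a set closed under the lines of \<open>u\<close>.\<close>

lemma proof_line_induct [consumes 2, case_names step]:
  assumes "is_proof G u \<chi>" and "l \<in> set u"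
    and step: "\<And>ps l. l \<in> set u \<Longrightarrow> G ps (sequent_of l) \<Longrightarrow> (\<And>p. p \<in> set ps \<Longrightarrow> P p) \<Longrightarrow> P (sequent_of l)"
  shows "P (sequent_of l)"
proof -
  have "P (sequent_of (u ! i))" if "i < length u" for i
    using that
  proof (induction i rule: less_induct)
    case (less i)
    obtain ps where ps: "set ps \<subseteq> sequent_of ` set (take i u)" "G ps (sequent_of (u ! i))"
      using assms(1) less.prems unfolding is_proof_def by blast
    show ?case
    proof (rule step[OF _ ps(2)])
      fix p
      assume "p \<in> set ps"
      with ps(1) have "p \<in> sequent_of ` set (take i u)"
        by blast
      then obtain j where "j < i" "p = sequent_of (u ! j)"
        using less.prems by (auto simp: in_set_conv_nth)
      with less show "P p"
        by simp
    qed (use less.prems in simp)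
  qed
  with assms(2) show ?thesis
    by (metis in_set_conv_nth)
qed

lemma proof_line_derivable:
  assumes "is_proof G u \<chi>" and "l \<in> set u"
  shows "derivable G (sequent_of l)"
  using assms by (induction rule: proof_line_induct) (blast intro: derivable.step)


section \<open>Maximal consistent sets\<close>

text \<open>A maximal consistent set appears here as a classical valuation that satisfies all
  derivable sequents, with boxed formulas opaque. Sequents with empty succedent give
  consistency.\<close>

definition world :: "calculus \<Rightarrow> fm set \<Rightarrow> bool" where
  "world G M \<longleftrightarrow>
     (\<forall>\<Gamma> \<Delta>. derivable G (\<Gamma>, \<Delta>) \<longrightarrow> set_mset \<Gamma> \<subseteq> M \<longrightarrow> set_mset \<Delta> \<inter> M \<noteq> {})"

definition entails :: "calculus \<Rightarrow> fm set \<Rightarrow> fm set \<Rightarrow> bool" where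
  "entails G M N \<longleftrightarrow> (\<exists>\<Gamma> \<Delta>. set_mset \<Gamma> \<subseteq> M \<and> set_mset \<Delta> \<subseteq> N \<and> derivable G (\<Gamma>, \<Delta>))"

lemma entails_mono: "entails G M N \<Longrightarrow> M \<subseteq> M' \<Longrightarrow> N \<subseteq> N' \<Longrightarrow> entails G M' N'"
  unfolding entails_def by blast

lemma mset_extract:
  "\<Gamma> = replicate_mset (count \<Gamma> A) A + filter_mset (\<lambda>B. B \<noteq> A) \<Gamma>"
  by (rule multiset_eqI) simp

locale classical_calculus =
  fixes G :: calculus
  assumes LK: "LK ps s \<Longrightarrow> G ps s"
begin

lemma derivable_LK: "LK ps s \<Longrightarrow> (\<And>p. p \<in> set ps \<Longrightarrow> derivable G p) \<Longrightarrow> derivable G s"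
  by (blast intro: derivable.step LK)

lemma derivable_LK0: "LK [] s \<Longrightarrow> derivable G s"
  by (rule derivable_LK) auto

lemma derivable_LK1: "LK [p] s \<Longrightarrow> derivable G p \<Longrightarrow> derivable G s"
  by (rule derivable_LK) auto

lemma derivable_LK2: "LK [p, q] s \<Longrightarrow> derivable G p \<Longrightarrow> derivable G q \<Longrightarrow> derivable G s"
  by (rule derivable_LK) auto

lemma derivable_weak:
  assumes "derivable G (\<Gamma>, \<Delta>)"
  shows "derivable G (\<Gamma> + \<Gamma>', \<Delta> + \<Delta>')"
proof -
  have "derivable G (\<Gamma> + \<Gamma>', \<Delta>)"
    by (induction \<Gamma>') (auto intro: assms derivable_LK1[OF LK.WeakL])
  then show ?thesis
    by (induction \<Delta>') (auto intro: derivable_LK1[OF LK.WeakR])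
qed

text \<open>The case \<open>n = 0\<close> is weakening. So any number of copies of \<open>A\<close>,
  even none, can be normalised to exactly one.\<close>

lemma derivable_contrL: "derivable G (replicate_mset n A + \<Gamma>, \<Delta>) \<Longrightarrow> derivable G (add_mset A \<Gamma>, \<Delta>)"
proof (induction n)
  case 0
  then show ?case by (auto intro: derivable_LK1[OF LK.WeakL])
next
  case (Suc n)
  then show ?case
    by (cases n) (auto intro: derivable_LK1[OF LK.ContrL])
qed

lemma derivable_contrR: "derivable G (\<Gamma>, replicate_mset n A + \<Delta>) \<Longrightarrow> derivable G (\<Gamma>, add_mset A \<Delta>)"
proof (induction n)
  case 0
  then show ?case by (auto intro: derivable_LK1[OF LK.WeakR])
next
  case (Suc n)
  then show ?case
    by (cases n) (auto intro: derivable_LK1[OF LK.ContrR])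
qed

lemma entails_cut:
  assumes "entails G (insert A M) N" and "entails G M (insert A N)"
  shows "entails G M N"
proof -
  obtain \<Gamma> \<Delta> where 1: "set_mset \<Gamma> \<subseteq> insert A M" "set_mset \<Delta> \<subseteq> N" "derivable G (\<Gamma>, \<Delta>)"
    using assms(1) unfolding entails_def by blast
  obtain \<Gamma>' \<Delta>' where 2: "set_mset \<Gamma>' \<subseteq> M" "set_mset \<Delta>' \<subseteq> insert A N" "derivable G (\<Gamma>', \<Delta>')"
    using assms(2) unfolding entails_def by blast
  \<comment> \<open>\<open>Cut\<close> removes a single copy, so first make the cut formula occur
    exactly once on the relevant side of each sequent.\<close>
  have "derivable G (add_mset A (filter_mset (\<lambda>B. B \<noteq> A) \<Gamma>), \<Delta>)"
    using 1(3) mset_extract by (metis derivable_contrL)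
  moreover have "derivable G (\<Gamma>', add_mset A (filter_mset (\<lambda>B. B \<noteq> A) \<Delta>'))"
    using 2(3) mset_extract by (metis derivable_contrR)
  ultimately have
    "derivable G (\<Gamma>' + filter_mset (\<lambda>B. B \<noteq> A) \<Gamma>, filter_mset (\<lambda>B. B \<noteq> A) \<Delta>' + \<Delta>)"
    by (blast intro: derivable_LK2[OF LK.Cut])
  then show ?thesis
    unfolding entails_def using 1(1,2) 2(1,2)
    by (intro exI[of _ "\<Gamma>' + filter_mset (\<lambda>B. B \<noteq> A) \<Gamma>"]
        exI[of _ "filter_mset (\<lambda>B. B \<noteq> A) \<Delta>' + \<Delta>"] conjI) auto
qed

lemma entails_cut_finite:
  assumes "finite F" and "\<And>B. B \<in> F \<Longrightarrow> entails G (insert B M) N" and "entails G M (F \<union> N)"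
  shows "entails G M N"
  using assms
proof (induction F rule: finite_induct)
  case (insert B F)
  have "entails G (insert B M) (F \<union> N)"
    using insert.prems(1)[of B] by (auto elim: entails_mono)
  then have "entails G M (F \<union> N)"
    using insert.prems(2) by (auto intro: entails_cut)
  with insert show ?case
    by auto
qed simp

text \<open>Zorn's lemma gives a maximal \<open>M\<close> that does not entail \<open>N\<close>; by
  cut, maximality forces \<open>M\<close> to satisfy every derivable sequent.\<close>

lemma lindenbaum:
  assumes "\<not> entails G {} N"
  obtains M where "world G M" and "N \<inter> M = {}"
proof -
  let ?\<C> = "{M. \<not> entails G M N}"
  have "\<exists>U\<in>?\<C>. \<forall>X\<in>c. X \<subseteq> U" if c: "subset.chain ?\<C> c" for c
  proof (cases "c = {}")
    case True
    with assms show ?thesis by auto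
  next
    case False
    have "\<not> entails G (\<Union>c) N"
    proof
      assume "entails G (\<Union>c) N"
      then obtain \<Gamma> \<Delta> where *: "set_mset \<Gamma> \<subseteq> \<Union>c" "set_mset \<Delta> \<subseteq> N" "derivable G (\<Gamma>, \<Delta>)"
        unfolding entails_def by blast
      \<comment> \<open>A derivation uses only finitely many formulas, so one member of the chain
        contains them all.\<close>
      then obtain X where "X \<in> c" "set_mset \<Gamma> \<subseteq> X"
        using finite_subset_Union_chain[OF _ *(1) False c] by auto
      with * c show False
        unfolding entails_def subset.chain_def by blast
    qed
    then show ?thesis by blast
  qed
  from subset_Zorn[OF this] obtain M
    where M: "\<not> entails G M N" and max: "\<And>X. \<not> entails G X N \<Longrightarrow> M \<subseteq> X \<Longrightarrow> X = M"
    by blast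
  show thesis
  proof
    show "world G M"
      unfolding world_def
    proof (intro allI impI notI)
      fix \<Gamma> \<Delta>
      assume \<Gamma>: "derivable G (\<Gamma>, \<Delta>)" "set_mset \<Gamma> \<subseteq> M" and disj: "set_mset \<Delta> \<inter> M = {}"
      \<comment> \<open>\<open>B\<close> lies outside \<open>M\<close>, so adding it must destroy
        non-entailment; cutting all such \<open>B\<close> then contradicts the choice of
        \<open>M\<close>.\<close>
      have "entails G (insert B M) N" if "B \<in># \<Delta>" for B
        using max[of "insert B M"] that disj by blast
      moreover have "entails G M (set_mset \<Delta> \<union> N)"
        unfolding entails_def using \<Gamma> by blast
      ultimately show False
        using M entails_cut_finite[of "set_mset \<Delta>"] by blast
    qed
    show "N \<inter> M = {}"
    proof (rule ccontr)
      assume "N \<inter> M \<noteq> {}"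
      then obtain A where "A \<in> N" "A \<in> M" by blast
      moreover have "derivable G ({#A#}, {#A#})"
        by (rule derivable_LK0[OF LK.Ax])
      ultimately have "entails G M N"
        unfolding entails_def by (intro exI[of _ "{#A#}"]) simp
      with M show False ..
    qed
  qed
qed

text \<open>Completeness: later memberships in the logic are checked world by world, without writing
  formal proofs.\<close>

lemma logic_of_worldI:
  assumes "\<And>M. world G M \<Longrightarrow> \<chi> \<in> M"
  shows "\<chi> \<in> logic_of G"
proof -
  have "entails G {} {\<chi>}"
    using lindenbaum[of "{\<chi>}"] assms by blast
  then obtain \<Delta> where \<Delta>: "set_mset \<Delta> \<subseteq> {\<chi>}" "derivable G ({#}, \<Delta>)"
    unfolding entails_def by auto
  have "filter_mset (\<lambda>B. B \<noteq> \<chi>) \<Delta> = {#}"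
    using \<Delta>(1) by (auto simp: filter_mset_eq_conv)
  then have "derivable G ({#}, {#\<chi>#})"
    using derivable_contrR \<Delta>(2) mset_extract by metis
  then show ?thesis
    by (rule derivable_imp_logic_of)
qed

lemma derivable_refl: "A \<in># \<Gamma> \<Longrightarrow> A \<in># \<Delta> \<Longrightarrow> derivable G (\<Gamma>, \<Delta>)"
  using derivable_weak[OF derivable_LK0[OF LK.Ax], of A "\<Gamma> - {#A#}" "\<Delta> - {#A#}"] by simp

section \<open>Truth conditions of the connectives in a world\<close>

context
  fixes M
  assumes M: "world G M"
begin

lemma worldD: "derivable G (\<Gamma>, \<Delta>) \<Longrightarrow> set_mset \<Gamma> \<subseteq> M \<Longrightarrow> \<exists>B\<in>set_mset \<Delta>. B \<in> M"
  using M unfolding world_def by blast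

lemma world_Top: "Top \<in> M"
  using worldD[OF derivable_LK0[OF LK.TopR]] by simp

lemma world_Bot: "Bot \<notin> M"
  using worldD[OF derivable_LK0[OF LK.BotL]] by auto

lemma world_And: "And A B \<in> M \<longleftrightarrow> A \<in> M \<and> B \<in> M"
proof -
  have "derivable G ({#And A B#}, {#A#})" "derivable G ({#And A B#}, {#B#})"
    using derivable_LK1[OF LK.AndL1] derivable_LK1[OF LK.AndL2] derivable_refl
    by (metis multi_member_last)+
  moreover have "derivable G ({#A, B#}, {#And A B#})"
    by (intro derivable_LK2[OF LK.AndR] derivable_refl) auto
  ultimately show ?thesis
    by (auto dest!: worldD)
qed

lemma world_Or: "Or A B \<in> M \<longleftrightarrow> A \<in> M \<or> B \<in> M"
proof -
  have "derivable G ({#A#}, {#Or A B#})" "derivable G ({#B#}, {#Or A B#})"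
    using derivable_LK1[OF LK.OrR1] derivable_LK1[OF LK.OrR2] derivable_refl
    by (metis multi_member_last)+
  moreover have "derivable G ({#Or A B#}, {#A, B#})"
    by (intro derivable_LK2[OF LK.OrL] derivable_refl) auto
  ultimately show ?thesis
    by (auto dest!: worldD)
qed

lemma world_Imp: "Imp A B \<in> M \<longleftrightarrow> (A \<in> M \<longrightarrow> B \<in> M)"
proof -
  have "derivable G ({#}, {#Imp A B, A#})" "derivable G ({#B#}, {#Imp A B#})"
    by (auto intro!: derivable_LK1[OF LK.ImpR] derivable_refl)
  moreover have "derivable G ({#Imp A B, A#}, {#B#})"
    by (intro derivable_LK2[OF LK.ImpL] derivable_refl) auto
  ultimately show ?thesis
    by (auto dest!: worldD)
qed

end

end


section \<open>The slash\<close>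

fun slash :: "bool \<Rightarrow> fm set \<Rightarrow> fm set \<Rightarrow> fm \<Rightarrow> bool" where
  "slash r M X (Atom n) \<longleftrightarrow> Atom n \<in> M"
| "slash r M X Top \<longleftrightarrow> True"
| "slash r M X Bot \<longleftrightarrow> False"
| "slash r M X (And A B) \<longleftrightarrow> slash r M X A \<and> slash r M X B"
| "slash r M X (Or A B) \<longleftrightarrow> slash r M X A \<or> slash r M X B"
| "slash r M X (Imp A B) \<longleftrightarrow> (slash r M X A \<longrightarrow> slash r M X B)"
| "slash r M X (Box A) \<longleftrightarrow> Box A \<in> X \<and> (r \<longrightarrow> slash r M X A)"

definition satisfies :: "(fm \<Rightarrow> bool) \<Rightarrow> sequent \<Rightarrow> bool" where
  "satisfies v s \<longleftrightarrow> ((\<forall>A\<in>#fst s. v A) \<longrightarrow> (\<exists>B\<in>#snd s. v B))"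

text \<open>Lines with one succedent suffice: the rules that introduce a box on the right conclude
  only such lines.\<close>

definition closed_under :: "line list \<Rightarrow> fm set \<Rightarrow> bool" where
  "closed_under u X \<longleftrightarrow> (\<forall>\<Gamma> A. (\<Gamma>, [A]) \<in> set u \<longrightarrow> set \<Gamma> \<subseteq> X \<longrightarrow> A \<in> X)"

lemma closed_underD:
  assumes "closed_under u X" and "l \<in> set u" and "sequent_of l = (\<Gamma>, {#A#})" and "set_mset \<Gamma> \<subseteq> X"
  shows "A \<in> X"
  using assms by (cases l) (auto simp: closed_under_def sequent_of_def)

text \<open>The slash commutes with the propositional connectives, so it is a classical valuation
  with boxed formulas as further atoms.\<close>

lemma LK_slash_sound:
  assumes "LK ps s" and "\<forall>p\<in>set ps. satisfies (slash r M X) p"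
  shows "satisfies (slash r M X) s"
  using assms by (cases rule: LK.cases) (auto simp: satisfies_def)

definition slash_sound :: "bool \<Rightarrow> calculus \<Rightarrow> bool" where
  "slash_sound r G \<longleftrightarrow> (\<forall>M X u ps l. closed_under u X \<longrightarrow> l \<in> set u \<longrightarrow> G ps (sequent_of l) \<longrightarrow>
     (\<forall>p\<in>set ps. satisfies (slash r M X) p) \<longrightarrow> satisfies (slash r M X) (sequent_of l))"

text \<open>The conjunct guarded by \<open>r\<close> makes \<open>BoxL\<close> sound. For
  \<open>BoxR\<close>, the true boxes of the antecedent lie in \<open>X\<close>, so closure puts
  \<open>Box \<phi>\<close> into \<open>X\<close>, and the premise makes \<open>\<phi>\<close>
  true.\<close>

lemma slash_sound_S4: "slash_sound True S4"
  unfolding slash_sound_def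
proof (intro allI impI)
  fix M X u ps l
  assume cl: "closed_under u X" "l \<in> set u" and "S4 ps (sequent_of l)"
    and ps: "\<forall>p\<in>set ps. satisfies (slash True M X) p"
  from this(3) show "satisfies (slash True M X) (sequent_of l)"
  proof cases
    case LK
    then show ?thesis
      using LK_slash_sound ps by blast
  next
    case BoxL
    then show ?thesis
      using ps by (auto simp: satisfies_def)
  next
    case (BoxR \<Gamma> \<phi>)
    then show ?thesis
      using ps closed_underD[OF cl BoxR(2)] by (auto simp: satisfies_def)
  qed
qed

text \<open>With \<open>r\<close> false a box is true iff it lies in \<open>X\<close>, so closure
  alone settles \<open>BoxGL\<close>. Demanding truth of \<open>\<phi>\<close> as well would be
  circular, as the premise has \<open>Box \<phi>\<close> in its antecedent.\<close>

lemma slash_sound_GL: "slash_sound False GL"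
  unfolding slash_sound_def
proof (intro allI impI)
  fix M X u ps l
  assume cl: "closed_under u X" "l \<in> set u" and "GL ps (sequent_of l)"
    and ps: "\<forall>p\<in>set ps. satisfies (slash False M X) p"
  from this(3) show "satisfies (slash False M X) (sequent_of l)"
  proof cases
    case LK
    then show ?thesis
      using LK_slash_sound ps by blast
  next
    case (BoxGL \<Gamma> \<phi>)
    then show ?thesis
      using closed_underD[OF cl BoxGL(2)] by (auto simp: satisfies_def)
  qed
qed

lemma proof_slash:
  assumes "slash_sound r G" and "closed_under u X" and "is_proof G u \<chi>"
  shows "slash r M X \<chi>"
proof -
  have "satisfies (slash r M X) (sequent_of l)" if "l \<in> set u" for l
    using assms(3) that
    by (induction rule: proof_line_induct) (use assms(1,2) in \<open>unfold slash_sound_def, blast\<close>)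
  moreover have "([], [\<chi>]) \<in> set u"
    using assms(3) unfolding is_proof_def by (metis last_in_set)
  ultimately show ?thesis
    by (fastforce simp: satisfies_def sequent_of_def)
qed


section \<open>The interpolants\<close>

text \<open>Arguments precede the formulas built from them, so for a monotone formula the list is
  already a straight-line program.\<close>

fun subfms :: "fm \<Rightarrow> fm list" where
  "subfms (And A B) = subfms A @ subfms B @ [And A B]"
| "subfms (Or A B) = subfms A @ subfms B @ [Or A B]"
| "subfms (Imp A B) = subfms A @ subfms B @ [Imp A B]"
| "subfms (Box A) = subfms A @ [Box A]"
| "subfms A = [A]"

lemma subfms_self: "A \<in> set (subfms A)"
  by (cases A) auto

lemma atoms_subfms: "B \<in> set (subfms A) \<Longrightarrow> atoms B \<subseteq> atoms A"
  by (induction A) auto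

lemma length_subfms: "length (subfms A) \<le> length (code_fm A)"
  by (induction A) auto

text \<open>Truth in \<open>M\<close> descends to subformulas and rises again as slash. An
  implication would need the converse transfer for its antecedent.\<close>

lemma (in classical_calculus) monotone_slash:
  assumes M: "world G M" and "r \<Longrightarrow> (\<And>A. Box A \<in> M \<Longrightarrow> A \<in> M)"
    and "monotone_fm A" and "set (subfms A) \<inter> M \<subseteq> X" and "A \<in> M"
  shows "slash r M X A"
  using assms(3-)
proof (induction A)
  case (Box A)
  have "slash r M X A" if r
    using Box assms(2)[OF that] by auto
  with Box show ?case by auto
qed (auto simp: world_And[OF M] world_Or[OF M] world_Bot[OF M])

fun conj_list :: "fm list \<Rightarrow> fm" where
  "conj_list [] = Top"
| "conj_list (A # As) = And A (conj_list As)"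

definition extend :: "line \<Rightarrow> (fm \<Rightarrow> fm) \<Rightarrow> fm \<Rightarrow> fm" where
  "extend l e = (case snd l of [A] \<Rightarrow> e(A := Or (e A) (conj_list (map e (fst l)))) | _ \<Rightarrow> e)"

text \<open>\<open>Bot\<close> fails in every world, so at first exactly the subformulas of
  \<open>\<phi>\<close> true in the world count as reached.\<close>

definition start :: "fm \<Rightarrow> fm \<Rightarrow> fm" where
  "start \<phi> B = (if B \<in> set (subfms \<phi>) then B else Bot)"

definition interpolants :: "line list \<Rightarrow> fm \<Rightarrow> fm \<Rightarrow> fm" where
  "interpolants u \<phi> = (fold extend u ^^ Suc (length u)) (start \<phi>)"

text \<open>The effect of \<^const>\<open>extend\<close> on the set of formulas whose approximation holds at a world.\<close>

definition fire :: "line \<Rightarrow> fm set \<Rightarrow> fm set" where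
  "fire l X = (case snd l of [A] \<Rightarrow> if set (fst l) \<subseteq> X then insert A X else X | _ \<Rightarrow> X)"

lemma list_single_cases:
  obtains (single) A where "xs = [A]" | (other) "\<And>A. xs \<noteq> [A]"
  by blast

lemma extend_simps:
  "extend (\<Gamma>, [A]) e = e(A := Or (e A) (conj_list (map e \<Gamma>)))"
  "(\<And>A. snd l \<noteq> [A]) \<Longrightarrow> extend l e = e"
  by (auto simp: extend_def split: list.splits)

lemma fire_simps:
  "fire (\<Gamma>, [A]) X = (if set \<Gamma> \<subseteq> X then insert A X else X)"
  "(\<And>A. snd l \<noteq> [A]) \<Longrightarrow> fire l X = X"
  by (auto simp: fire_def split: list.splits)

context classical_calculus
begin

lemma world_conj_list:
  assumes "world G M"
  shows "conj_list As \<in> M \<longleftrightarrow> set As \<subseteq> M"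
  by (induction As) (auto simp: world_Top[OF assms] world_And[OF assms])

text \<open>Worlds respect \<open>Or\<close> and finite conjunctions, so the syntactic update
  becomes the firing of a Horn clause, uniformly in the world.\<close>

lemma extend_world:
  assumes "world G M"
  shows "{B. extend l e B \<in> M} = fire l {B. e B \<in> M}"
proof -
  obtain \<Gamma> \<Delta> where l: "l = (\<Gamma>, \<Delta>)" by fastforce
  show ?thesis
    by (cases \<Delta> rule: list_single_cases)
      (auto simp: l extend_simps fire_simps world_Or[OF assms] world_conj_list[OF assms])
qed

lemma fold_extend_world:
  assumes "world G M"
  shows "{B. fold extend u e B \<in> M} = fold fire u {B. e B \<in> M}"
  by (induction u arbitrary: e) (simp_all add: extend_world[OF assms])

lemma funpow_extend_world:
  assumes "world G M"
  shows "{B. (fold extend u ^^ n) e B \<in> M} = (fold fire u ^^ n) {B. e B \<in> M}"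
  by (induction n) (simp_all add: fold_extend_world[OF assms])

end

section \<open>Iterated firing reaches a closed set\<close>

lemma fire_increasing: "X \<subseteq> fire l X"
  by (auto simp: fire_def split: list.splits)

lemma fold_fire_increasing: "X \<subseteq> fold fire u X"
  by (induction u arbitrary: X) (use fire_increasing in fastforce)+

lemma funpow_fire_increasing: "X \<subseteq> (fold fire u ^^ n) X"
  by (induction n) (use fold_fire_increasing in fastforce)+

text \<open>Within a round the set only grows, so a clause whose body lies in \<open>X\<close> still
  fires when its turn comes, and its head survives to the end of the round.\<close>

lemma fixpoint_closed_under:
  assumes "fold fire u X = X"
  shows "closed_under u X"
  unfolding closed_under_def
proof (intro allI impI)
  fix \<Gamma> A
  assume "(\<Gamma>, [A]) \<in> set u" and \<Gamma>: "set \<Gamma> \<subseteq> X"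
  then obtain p q where u: "u = p @ (\<Gamma>, [A]) # q"
    by (meson split_list)
  let ?Y = "fold fire p X"
  have "A \<in> fire (\<Gamma>, [A]) ?Y"
    using \<Gamma> fold_fire_increasing[of X p] by (auto simp: fire_simps)
  also have "\<dots> \<subseteq> fold fire u X"
    by (simp add: u fold_fire_increasing)
  finally show "A \<in> X"
    by (simp add: assms)
qed

text \<open>If the succedent is not a singleton, \<open>hd\<close> is an arbitrary or unspecified
  value, which merely enlarges the bound.\<close>

lemma fire_heads: "fire l X \<subseteq> X \<union> {hd (snd l)}"
  by (auto simp: fire_def split: list.splits)

lemma fold_fire_heads: "fold fire u X \<subseteq> X \<union> (\<lambda>l. hd (snd l)) ` set u"
proof (induction u arbitrary: X)
  case (Cons l u)
  from Cons[of "fire l X"] fire_heads[of l X] show ?case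
    by auto
qed simp

lemma funpow_fire_heads: "(fold fire u ^^ n) X \<subseteq> X \<union> (\<lambda>l. hd (snd l)) ` set u"
proof (induction n)
  case (Suc n)
  then show ?case
    using fold_fire_heads[of u "(fold fire u ^^ n) X"] by auto
qed simp

text \<open>Every round before the iteration becomes stationary adds a formula. Only formulas
  outside \<open>X\<close> are counted: they are heads of lines, hence finitely many even if
  \<open>X\<close> is infinite.\<close>

lemma funpow_fire_card:
  fixes u X
  defines "g \<equiv> \<lambda>n. (fold fire u ^^ n) X"
  shows "fold fire u (g n) = g n \<or> n \<le> card (g n - X)"
proof (induction n)
  case (Suc n)
  have S: "g (Suc n) = fold fire u (g n)"
    by (simp add: g_def)
  show ?case
  proof (cases "fold fire u (g n) = g n")
    case True
    then show ?thesis by (simp add: S)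
  next
    case False
    then have "g n \<subset> g (Suc n)" "X \<subseteq> g n"
      using fold_fire_increasing[of "g n" u] funpow_fire_increasing[of X n u]
      by (auto simp: S g_def)
    then have "g n - X \<subset> g (Suc n) - X"
      by blast
    moreover have "finite (g (Suc n) - X)"
      by (rule finite_subset[of _ "(\<lambda>l. hd (snd l)) ` set u"])
        (use funpow_fire_heads[of "Suc n" u X] in \<open>auto simp: g_def\<close>)
    ultimately have "card (g n - X) < card (g (Suc n) - X)"
      by (rule psubset_card_mono[rotated])
    with Suc False show ?thesis by auto
  qed
qed simp

text \<open>At most \<open>length u\<close> heads can be added, so \<open>Suc (length u)\<close>
  rounds cannot all have been productive up to the end.\<close>

lemma funpow_fire_closed: "closed_under u ((fold fire u ^^ Suc (length u)) X)" (is "closed_under u ?Y")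
proof -
  have "card (?Y - X) \<le> card ((\<lambda>l. hd (snd l)) ` set u)"
    by (rule card_mono) (use funpow_fire_heads[of "Suc (length u)" u X] in auto)
  also have "\<dots> \<le> length u"
    by (meson card_image_le card_length finite_set le_trans)
  finally have "\<not> Suc (length u) \<le> card (?Y - X)"
    by simp
  then show ?thesis
    using funpow_fire_card[where n = "Suc (length u)"] by (blast intro: fixpoint_closed_under)
qed

lemma fold_fire_subset:
  assumes "closed_under u M" and "X \<subseteq> M"
  shows "fold fire u X \<subseteq> M"
  using assms
proof (induction u arbitrary: X)
  case (Cons l u)
  obtain \<Gamma> \<Delta> where l: "l = (\<Gamma>, \<Delta>)" by fastforce
  have "fire l X \<subseteq> M"
    using Cons.prems
    by (cases \<Delta> rule: list_single_cases) (auto simp: l fire_simps closed_under_def)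
  moreover have "closed_under u M"
    using Cons.prems(1) by (auto simp: closed_under_def)
  ultimately show ?case
    using Cons.IH by simp
qed simp

lemma funpow_fire_subset:
  assumes "closed_under u M" and "X \<subseteq> M"
  shows "(fold fire u ^^ n) X \<subseteq> M"
  using assms(2) by (induction n) (simp_all add: fold_fire_subset[OF assms(1)])

section \<open>The interpolation properties, world by world\<close>

context classical_calculus
begin

lemma start_world:
  assumes "world G M"
  shows "{B. start \<phi> B \<in> M} = set (subfms \<phi>) \<inter> M"
  by (auto simp: start_def world_Bot[OF assms] split: if_splits)

lemma world_closed_under:
  assumes "world G M" and "is_proof G u \<chi>"
  shows "closed_under u M"
  unfolding closed_under_def
proof (intro allI impI)
  fix \<Gamma> A
  assume "(\<Gamma>, [A]) \<in> set u" "set \<Gamma> \<subseteq> M"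
  then show "A \<in> M"
    using worldD[OF assms(1), of "mset \<Gamma>" "{#A#}"] proof_line_derivable[OF assms(2), of "(\<Gamma>, [A])"]
    by (auto simp: sequent_of_def)
qed

text \<open>Firing starts from formulas true in \<open>M\<close>, and \<open>M\<close> is closed
  under the derivable lines of \<open>u\<close>, so only true formulas are reached.\<close>

lemma interpolants_imp:
  assumes "is_proof G u \<chi>" and M: "world G M" and "interpolants u \<phi> B \<in> M"
  shows "B \<in> M"
proof -
  have "{B. interpolants u \<phi> B \<in> M} \<subseteq> M"
    unfolding interpolants_def funpow_extend_world[OF M] start_world[OF M]
    by (rule funpow_fire_subset) (auto intro: world_closed_under[OF M assms(1)])
  with assms(3) show ?thesis by blast
qed

lemma interpolants_disj:
  assumes u: "is_proof G u (Imp \<phi> (Or (Box \<psi>) (Box \<theta>)))" and mono: "monotone_fm \<phi>"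
    and sound: "slash_sound r G" and refl: "r \<Longrightarrow> (\<And>A. Box A \<in> M \<Longrightarrow> A \<in> M)"
    and M: "world G M" and \<phi>: "\<phi> \<in> M"
  shows "interpolants u \<phi> (Box \<psi>) \<in> M \<or> interpolants u \<phi> (Box \<theta>) \<in> M"
proof -
  define X where "X = {B. interpolants u \<phi> B \<in> M}"
  have X: "X = (fold fire u ^^ Suc (length u)) (set (subfms \<phi>) \<inter> M)"
    unfolding X_def interpolants_def funpow_extend_world[OF M] start_world[OF M] ..
  have "slash r M X (Imp \<phi> (Or (Box \<psi>) (Box \<theta>)))"
    by (rule proof_slash[OF sound _ u]) (unfold X, rule funpow_fire_closed)
  moreover have "set (subfms \<phi>) \<inter> M \<subseteq> X"
    unfolding X by (rule funpow_fire_increasing)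
  then have "slash r M X \<phi>"
    using monotone_slash[OF M refl mono] \<phi> by blast
  \<comment> \<open>The slash of a box includes its membership in \<open>X\<close>, which is the
    truth of the corresponding interpolant in \<open>M\<close>.\<close>
  ultimately show ?thesis
    by (auto simp: X_def)
qed

end

lemma atoms_conj_list: "(\<And>A. A \<in> set As \<Longrightarrow> atoms A \<subseteq> P) \<Longrightarrow> atoms (conj_list As) \<subseteq> P"
  by (induction As) auto

lemma atoms_extend:
  assumes "\<And>B. atoms (e B) \<subseteq> P"
  shows "atoms (extend l e B) \<subseteq> P"
proof -
  obtain \<Gamma> \<Delta> where l: "l = (\<Gamma>, \<Delta>)" by fastforce
  have "atoms (conj_list (map e \<Gamma>)) \<subseteq> P"
    by (rule atoms_conj_list) (use assms in auto)
  with assms show ?thesis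
    by (cases \<Delta> rule: list_single_cases) (simp_all add: l extend_simps)
qed

lemma atoms_fold_extend: "(\<And>B. atoms (e B) \<subseteq> P) \<Longrightarrow> atoms (fold extend u e B) \<subseteq> P"
  by (induction u arbitrary: e) (simp_all add: atoms_extend)

lemma atoms_funpow_extend: "(\<And>B. atoms (e B) \<subseteq> P) \<Longrightarrow> atoms ((fold extend u ^^ n) e B) \<subseteq> P"
  by (induction n arbitrary: B) (simp_all add: atoms_fold_extend)

text \<open>Formulas with foreign atoms start at \<open>Bot\<close>, and updates only combine
  existing approximations.\<close>

lemma atoms_interpolants: "atoms (interpolants u \<phi> B) \<subseteq> atoms \<phi>"
  unfolding interpolants_def by (rule atoms_funpow_extend) (simp add: start_def atoms_subfms)


section \<open>Circuits\<close>

text \<open>The lists of formulas that are unfoldings of circuits.\<close>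

inductive straight_line :: "fm list \<Rightarrow> bool" where
  Nil: "straight_line []"
| Atom: "straight_line Fs \<Longrightarrow> straight_line (Fs @ [Atom n])"
| Top: "straight_line Fs \<Longrightarrow> straight_line (Fs @ [Top])"
| Bot: "straight_line Fs \<Longrightarrow> straight_line (Fs @ [Bot])"
| And: "straight_line Fs \<Longrightarrow> A \<in> set Fs \<Longrightarrow> B \<in> set Fs \<Longrightarrow> straight_line (Fs @ [And A B])"
| Or: "straight_line Fs \<Longrightarrow> A \<in> set Fs \<Longrightarrow> B \<in> set Fs \<Longrightarrow> straight_line (Fs @ [Or A B])"
| Box: "straight_line Fs \<Longrightarrow> A \<in> set Fs \<Longrightarrow> straight_line (Fs @ [Box A])"

lemma straight_line_append: "straight_line Es \<Longrightarrow> straight_line Fs \<Longrightarrow> straight_line (Fs @ Es)"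
proof (induction rule: straight_line.induct)
  case (Atom Es n)
  then show ?case using straight_line.Atom[of "Fs @ Es"] by simp
next
  case (Top Es)
  then show ?case using straight_line.Top[of "Fs @ Es"] by simp
next
  case (Bot Es)
  then show ?case using straight_line.Bot[of "Fs @ Es"] by simp
next
  case (And Es A B)
  then show ?case using straight_line.And[of "Fs @ Es"] by simp
next
  case (Or Es A B)
  then show ?case using straight_line.Or[of "Fs @ Es"] by simp
next
  case (Box Es A)
  then show ?case using straight_line.Box[of "Fs @ Es"] by simp
qed simp

lemma straight_line_subfms: "monotone_fm A \<Longrightarrow> straight_line (subfms A)"
proof (induction A)
  case (Atom n)
  then show ?case using straight_line.Atom[OF straight_line.Nil] by simp
next
  case Top
  then show ?case using straight_line.Top[OF straight_line.Nil] by simp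
next
  case Bot
  then show ?case using straight_line.Bot[OF straight_line.Nil] by simp
next
  case (And A B)
  then show ?case
    using straight_line.And[OF straight_line_append[of "subfms B" "subfms A"]] subfms_self by simp
next
  case (Or A B)
  then show ?case
    using straight_line.Or[OF straight_line_append[of "subfms B" "subfms A"]] subfms_self by simp
next
  case (Box A)
  then show ?case
    using straight_line.Box[of "subfms A"] subfms_self by simp
qed simp

lemma unfold_gates_snoc: "unfold_gates (C @ [g]) = unfold_gates C @ [gate_fm (unfold_gates C) g]"
  by (simp add: unfold_gates_def)

lemma length_unfold_gates: "length (unfold_gates C) = length C"
  by (induction C rule: rev_induct) (simp_all add: unfold_gates_snoc, simp add: unfold_gates_def)

definition gates_wf :: "mcircuit \<Rightarrow> bool" where
  "gates_wf C \<longleftrightarrow> (\<forall>k<length C. \<forall>i\<in>gate_inputs (C ! k). i < k)"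

lemma gates_wf_snoc:
  "gates_wf C \<Longrightarrow> (\<And>i. i \<in> gate_inputs g \<Longrightarrow> i < length C) \<Longrightarrow> gates_wf (C @ [g])"
  by (auto simp: gates_wf_def nth_append less_Suc_eq)

text \<open>Each formula becomes one gate whose inputs are earlier positions of its arguments, so
  lengths agree.\<close>

lemma straight_line_circuit: "straight_line Fs \<Longrightarrow> \<exists>C. gates_wf C \<and> unfold_gates C = Fs"
proof (induction rule: straight_line.induct)
  case Nil
  show ?case by (rule exI[of _ "[]"]) (simp add: gates_wf_def unfold_gates_def)
next
  case (Atom Fs n)
  then obtain C where "gates_wf C" "unfold_gates C = Fs" by blast
  then show ?case
    by (intro exI[of _ "C @ [GAtom n]"]) (auto simp: unfold_gates_snoc intro: gates_wf_snoc)
next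
  case (Top Fs)
  then obtain C where "gates_wf C" "unfold_gates C = Fs" by blast
  then show ?case
    by (intro exI[of _ "C @ [GTop]"]) (auto simp: unfold_gates_snoc intro: gates_wf_snoc)
next
  case (Bot Fs)
  then obtain C where "gates_wf C" "unfold_gates C = Fs" by blast
  then show ?case
    by (intro exI[of _ "C @ [GBot]"]) (auto simp: unfold_gates_snoc intro: gates_wf_snoc)
next
  case (And Fs A B)
  then obtain C where C: "gates_wf C" "unfold_gates C = Fs" by blast
  obtain i j where "i < length C" "Fs ! i = A" "j < length C" "Fs ! j = B"
    using And.hyps C(2) length_unfold_gates[of C] by (metis in_set_conv_nth)
  with C show ?case
    by (intro exI[of _ "C @ [GAnd i j]"]) (auto simp: unfold_gates_snoc intro!: gates_wf_snoc)
next
  case (Or Fs A B)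
  then obtain C where C: "gates_wf C" "unfold_gates C = Fs" by blast
  obtain i j where "i < length C" "Fs ! i = A" "j < length C" "Fs ! j = B"
    using Or.hyps C(2) length_unfold_gates[of C] by (metis in_set_conv_nth)
  with C show ?case
    by (intro exI[of _ "C @ [GOr i j]"]) (auto simp: unfold_gates_snoc intro!: gates_wf_snoc)
next
  case (Box Fs A)
  then obtain C where C: "gates_wf C" "unfold_gates C = Fs" by blast
  obtain i where "i < length C" "Fs ! i = A"
    using Box.hyps C(2) length_unfold_gates[of C] by (metis in_set_conv_nth)
  with C show ?case
    by (intro exI[of _ "C @ [GBox i]"]) (auto simp: unfold_gates_snoc intro!: gates_wf_snoc)
qed

text \<open>One list holds all values of \<open>e\<close> simultaneously, so updates share them.
  \<open>Top\<close> is kept available as the empty conjunction.\<close>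

definition computable_within :: "nat \<Rightarrow> (fm \<Rightarrow> fm) \<Rightarrow> bool" where
  "computable_within n e \<longleftrightarrow>
     (\<exists>Fs. straight_line Fs \<and> Top \<in> set Fs \<and> range e \<subseteq> set Fs \<and> length Fs \<le> n)"

lemma computable_within_mono: "computable_within m e \<Longrightarrow> m \<le> n \<Longrightarrow> computable_within n e"
  unfolding computable_within_def by (meson le_trans)

lemma straight_line_conj_list:
  assumes "straight_line Fs" and "Top \<in> set Fs" and "set As \<subseteq> set Fs"
  shows "\<exists>Es. straight_line (Fs @ Es) \<and> conj_list As \<in> set (Fs @ Es) \<and> length Es \<le> length As"
  using assms(3)
proof (induction As)
  case Nil
  then show ?case using assms by (intro exI[of _ "[]"]) simp
next
  case (Cons A As)
  then obtain Es where
    Es: "straight_line (Fs @ Es)" "conj_list As \<in> set (Fs @ Es)" "length Es \<le> length As"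
    by auto
  moreover have "straight_line ((Fs @ Es) @ [And A (conj_list As)])"
    using Es(1,2) Cons.prems by (intro straight_line.And) auto
  ultimately show ?case
    by (intro exI[of _ "Es @ [And A (conj_list As)]"]) auto
qed

text \<open>The conjunction costs one gate per antecedent formula and the disjunction one more; all
  old values stay available.\<close>

lemma computable_within_extend:
  assumes "computable_within n e"
  shows "computable_within (n + length (fst l) + 1) (extend l e)"
proof -
  obtain Fs where Fs: "straight_line Fs" "Top \<in> set Fs" "range e \<subseteq> set Fs" "length Fs \<le> n"
    using assms unfolding computable_within_def by blast
  obtain \<Gamma> \<Delta> where l: "l = (\<Gamma>, \<Delta>)" by fastforce
  show ?thesis
  proof (cases \<Delta> rule: list_single_cases)
    case (single A)
    obtain Es where Es: "straight_line (Fs @ Es)" "conj_list (map e \<Gamma>) \<in> set (Fs @ Es)"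
      "length Es \<le> length \<Gamma>"
      using straight_line_conj_list[OF Fs(1,2), of "map e \<Gamma>"] Fs(3) by auto
    let ?F = "Or (e A) (conj_list (map e \<Gamma>))"
    have "straight_line ((Fs @ Es) @ [?F])"
      using Es(1,2) Fs(3) by (intro straight_line.Or) auto
    with Es Fs show ?thesis
      unfolding computable_within_def
      by (intro exI[of _ "(Fs @ Es) @ [?F]"]) (auto simp: l single extend_simps)
  next
    case other
    then show ?thesis
      using computable_within_mono[OF assms] by (simp add: l extend_simps)
  qed
qed

lemma length_code_fm_pos: "0 < length (code_fm A)"
  by (cases A) auto

lemma length_code_fms: "length \<Gamma> + 3 \<le> length (code_fms \<Gamma>)"
proof (induction \<Gamma>)
  case (Cons A \<Gamma>)
  then show ?case
    using length_code_fm_pos[of A] by (simp add: code_fms_def del: length_greater_0_conv)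
qed (simp add: code_fms_def)

text \<open>The summand 2 covers the disjunction gate of an update and also yields the factor 2 in
  \<open>length_code_proof\<close>, which absorbs the extra round.\<close>

lemma length_code_proof_Cons:
  "length (fst l) + 2 + length (code_proof u) \<le> length (code_proof (l # u))"
  using length_code_fms[of "fst l"] by (cases l) (simp add: code_proof_def)

lemma length_code_proof: "2 * length u \<le> length (code_proof u)"
proof (induction u)
  case (Cons l u)
  then show ?case using length_code_proof_Cons[of l u] by simp
qed simp

lemma computable_within_fold_extend:
  "computable_within n e \<Longrightarrow> computable_within (n + length (code_proof u)) (fold extend u e)"
proof (induction u arbitrary: n e)
  case Nil
  then show ?case by (auto elim: computable_within_mono)
next
  case (Cons l u)
  from Cons.IH[OF computable_within_extend[OF Cons.prems, of l]] show ?case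
    using length_code_proof_Cons[of l u] by (auto elim: computable_within_mono)
qed

lemma computable_within_funpow_extend:
  assumes "computable_within n e"
  shows "computable_within (n + k * length (code_proof u)) ((fold extend u ^^ k) e)"
proof (induction k)
  case (Suc k)
  from computable_within_fold_extend[OF this, of u] show ?case
    by (simp add: algebra_simps)
qed (simp add: assms)

lemma computable_within_start:
  assumes "monotone_fm \<phi>"
  shows "computable_within (length (code_fm \<phi>) + 2) (start \<phi>)"
  unfolding computable_within_def
proof (intro exI conjI)
  have "straight_line [Top, Bot]"
    using straight_line.Bot[OF straight_line.Top[OF straight_line.Nil]] by simp
  then show "straight_line ([Top, Bot] @ subfms \<phi>)"
    by (intro straight_line_append straight_line_subfms assms)
qed (use length_subfms[of \<phi>] in \<open>auto simp: start_def\<close>)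

text \<open>The value of a circuit is its last gate; a final disjunction \<open>e B \<or> e B\<close> makes \<open>e B\<close> the
  output.\<close>

lemma computable_within_circuit:
  assumes "computable_within n e"
  shows "\<exists>C. is_mcircuit C \<and> circuit_size C \<le> n + 1 \<and> circuit_fm C = Or (e B) (e B)"
proof -
  obtain Fs where Fs: "straight_line Fs" "range e \<subseteq> set Fs" "length Fs \<le> n"
    using assms unfolding computable_within_def by blast
  then have "straight_line (Fs @ [Or (e B) (e B)])"
    by (intro straight_line.Or) auto
  then obtain C where C: "gates_wf C" "unfold_gates C = Fs @ [Or (e B) (e B)]"
    using straight_line_circuit by blast
  then have "length C = Suc (length Fs)"
    using length_unfold_gates[of C] by simp
  with C Fs(3) show ?thesis
    by (intro exI[of _ C])
      (auto simp: is_mcircuit_def gates_wf_def circuit_size_def circuit_fm_def)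
qed

lemma interpolants_circuit:
  assumes "monotone_fm \<phi>" and "u \<noteq> []"
  shows "\<exists>C. is_mcircuit C \<and>
    circuit_size C \<le> length (code_fm \<phi>) + 3 + length (code_proof u) ^ 2 \<and>
    circuit_fm C = Or (interpolants u \<phi> B) (interpolants u \<phi> B)"
proof -
  have "computable_within
      (length (code_fm \<phi>) + 2 + Suc (length u) * length (code_proof u)) (interpolants u \<phi>)"
    unfolding interpolants_def
    by (intro computable_within_funpow_extend computable_within_start assms)
  \<comment> \<open>Since \<open>u\<close> is nonempty, the number of rounds is at most twice its
    length and hence at most the length of its code.\<close>
  moreover have "Suc (length u) \<le> 2 * length u"
    using assms(2) by (cases u) auto
  then have "Suc (length u) * length (code_proof u) \<le> length (code_proof u) ^ 2"
    unfolding power2_eq_square using length_code_proof[of u] by (intro mult_right_mono) linarith+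
  ultimately have "computable_within
      (length (code_fm \<phi>) + 2 + length (code_proof u) ^ 2) (interpolants u \<phi>)"
    by (auto elim!: computable_within_mono)
  from computable_within_circuit[OF this, of B] show ?thesis
    by (auto simp: algebra_simps numeral_3_eq_3)
qed

section \<open>The two calculi and the final bound\<close>

lemma classical_calculus_S4: "classical_calculus S4"
  by unfold_locales (rule S4.LK)

lemma classical_calculus_GL: "classical_calculus GL"
  by unfold_locales (rule GL.LK)

lemma world_S4_Box:
  assumes "world S4 M" and "Box A \<in> M"
  shows "A \<in> M"
proof -
  interpret classical_calculus S4 by (rule classical_calculus_S4)
  have "derivable S4 ({#Box A#}, {#A#})"
    by (rule derivable.step[where G = S4, OF S4.BoxL]) (simp add: derivable_refl)
  from worldD[OF assms(1) this] assms(2) show ?thesis by simp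
qed

theorem theorem7p16:
  fixes G :: calculus
  assumes "G \<in> {S4, GL}"
  shows "\<exists>p :: nat poly poly. \<forall>u \<phi> \<psi> \<theta> w.
    is_proof G u (Imp \<phi> (Or (Box \<psi>) (Box \<theta>))) \<longrightarrow> monotone_fm \<phi> \<longrightarrow>
    w = code_fm (Imp \<phi> (Or (Box \<psi>) (Box \<theta>))) \<longrightarrow>
    (\<exists>C D. is_mcircuit C \<and> is_mcircuit D \<and>
       circuit_size C \<le> poly2 p (length (code_proof u)) (length w) \<and>
       circuit_size D \<le> poly2 p (length (code_proof u)) (length w) \<and>
       is_MDI (logic_of G) (circuit_fm C, circuit_fm D) \<phi> \<psi> \<theta>)"
\<comment> \<open>The polynomial is \<open>x^2 + y + 3\<close>, with \<open>x\<close> the code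
  length of the proof and \<open>y\<close> that of the formula.\<close>
proof (intro exI[of _ "[:[:3, 0, 1:], 1:]"] allI impI)
  fix u \<phi> \<psi> \<theta> w
  assume u: "is_proof G u (Imp \<phi> (Or (Box \<psi>) (Box \<theta>)))" and mono: "monotone_fm \<phi>"
    and w: "w = code_fm (Imp \<phi> (Or (Box \<psi>) (Box \<theta>)))"
  interpret classical_calculus G
    using assms classical_calculus_S4 classical_calculus_GL by auto
  \<comment> \<open>Take \<open>r\<close> true for \<open>S4\<close> and false for
    \<open>GL\<close>, where \<open>refl\<close> is vacuous.\<close>
  obtain r where sound: "slash_sound r G"
    and refl: "\<And>M A. r \<Longrightarrow> world G M \<Longrightarrow> Box A \<in> M \<Longrightarrow> A \<in> M"
    using assms slash_sound_S4 slash_sound_GL world_S4_Box by auto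
  let ?e = "interpolants u \<phi>"
  have "u \<noteq> []"
    using u by (simp add: is_proof_def)
  note circuit = interpolants_circuit[OF mono this]
  obtain C where C: "is_mcircuit C"
    "circuit_size C \<le> length (code_fm \<phi>) + 3 + length (code_proof u) ^ 2"
    "circuit_fm C = Or (?e (Box \<psi>)) (?e (Box \<psi>))"
    using circuit by blast
  obtain D where D: "is_mcircuit D"
    "circuit_size D \<le> length (code_fm \<phi>) + 3 + length (code_proof u) ^ 2"
    "circuit_fm D = Or (?e (Box \<theta>)) (?e (Box \<theta>))"
    using circuit by blast
  have size: "length (code_fm \<phi>) + 3 + length (code_proof u) ^ 2
    \<le> poly2 [:[:3, 0, 1:], 1:] (length (code_proof u)) (length w)"
    by (simp add: poly2_def w power2_eq_square)
  have "is_MDI (logic_of G) (circuit_fm C, circuit_fm D) \<phi> \<psi> \<theta>"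
    unfolding is_MDI_def prod.case
  proof (intro conjI)
    show "Imp \<phi> (Or (Box \<psi>) (Box \<theta>)) \<in> logic_of G"
      using u by (auto simp: logic_of_def)
    show "atoms (circuit_fm C) \<subseteq> atoms \<phi>" "atoms (circuit_fm D) \<subseteq> atoms \<phi>"
      by (simp_all add: C(3) D(3) atoms_interpolants)
    \<comment> \<open>In a world the doubled disjunctions output by \<open>C\<close> and
      \<open>D\<close> have the truth values of the interpolants themselves.\<close>
    show "Imp \<phi> (Or (circuit_fm C) (circuit_fm D)) \<in> logic_of G"
      using interpolants_disj[OF u mono sound refl]
      by (intro logic_of_worldI) (auto simp: C(3) D(3) world_Imp world_Or)
    show "Imp (circuit_fm C) (Box \<psi>) \<in> logic_of G" "Imp (circuit_fm D) (Box \<theta>) \<in> logic_of G"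
      using interpolants_imp[OF u]
      by (auto intro!: logic_of_worldI simp: C(3) D(3) world_Imp world_Or)
  qed
  with C(1,2) D(1,2) size show "\<exists>C D. is_mcircuit C \<and> is_mcircuit D \<and>
       circuit_size C \<le> poly2 [:[:3, 0, 1:], 1:] (length (code_proof u)) (length w) \<and>
       circuit_size D \<le> poly2 [:[:3, 0, 1:], 1:] (length (code_proof u)) (length w) \<and>
       is_MDI (logic_of G) (circuit_fm C, circuit_fm D) \<phi> \<psi> \<theta>"
    by (meson le_trans)
qed

end
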